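(* Let $m\ge 1$. Let $h^u$ and $\tilde h^u$ be two step-up procedures with threshold functions $\tau^u_\alpha$ and $\tilde\tau^u_\alpha$, each satisfying the threshold condition: (1) the threshold function at $i$ is non-decreasing in $i$ for each fixed $\alpha$; (2) the threshold function at $i$ is continuous in $\alpha$ and non-decreasing in $\alpha$ for each fixed $i$. Then the union $h^u\cup\tilde h^u$, which is characterised as a step-up procedure by the threshold function $\tau_\alpha(i)=\max(\tau^u_\alpha(i),\tilde\tau^u_\alpha(i))$, also satisfies the threshold condition, i.e. $\tau_\alpha$ satisfies (1) and (2).
   Context: For $p\in[0,1]^m$ let $p_{(1)}\le\cdots\le p_{(m)}$ be its ordered entries. A threshold function is a family of maps $\tau_\alpha:\{1,\ldots,m\}\to[0,1]$, $\alpha\in[0,1]$. The step-up procedure with threshold function $\tau_\alpha$ sends $(p,\alpha)\in[0,1]^m\times[0,1]$ to the set $\{i\in\{1,\ldots,m\}: p_i\le\max\{p_{(j)}: p_{(j)}\le\tau_\alpha(j)\}\}$ of indices of rejected hypotheses (maximum over the empty set equal to $-\infty$, i.e. no rejections). The union of two procedures is $(h_1\cup h_2)(p,\alpha)=h_1(p,\alpha)\cup h_2(p,\alpha)$; the union of two step-up procedures is represented by the pointwise maximum of their threshold functions. A step-up procedure is said to satisfy the threshold condition if its threshold function does. *)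

theory Defs
  imports Complex_Main "HOL-Library.FuncSet"
begin

text \<open>
  Vectors \<open>p\<close> indexed by \<open>{1..m}\<close> are functions \<open>nat \<Rightarrow> real\<close>; only the values on \<open>{1..m}\<close> matter.
  Threshold functions take the level first: \<open>\<tau> \<alpha> i\<close> is the value of \<open>\<tau>\<^sub>\<alpha>\<close> at \<open>i\<close>.
\<close>

type_synonym procedure = "(nat \<Rightarrow> real) \<Rightarrow> real \<Rightarrow> nat set"

definition order_stat :: "nat \<Rightarrow> (nat \<Rightarrow> real) \<Rightarrow> nat \<Rightarrow> real" where
  "order_stat m p j = sort (map p [1..<Suc m]) ! (j - 1)"

definition threshold_function :: "nat \<Rightarrow> (real \<Rightarrow> nat \<Rightarrow> real) \<Rightarrow> bool" where
  "threshold_function m \<tau> \<longleftrightarrow> (\<forall>\<alpha>\<in>{0..1}. \<tau> \<alpha> \<in> {1..m} \<rightarrow> {0..1})"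

text \<open>The case distinction implements the convention that the maximum of the empty set is \<open>-\<infinity>\<close>.\<close>

definition step_up_rejections :: "nat \<Rightarrow> (nat \<Rightarrow> real) \<Rightarrow> (nat \<Rightarrow> real) \<Rightarrow> nat set" where
  "step_up_rejections m t p =
    (let S = {order_stat m p j | j. j \<in> {1..m} \<and> order_stat m p j \<le> t j}
     in if S = {} then {} else {i \<in> {1..m}. p i \<le> Max S})"

definition step_up_procedure :: "nat \<Rightarrow> procedure \<Rightarrow> (real \<Rightarrow> nat \<Rightarrow> real) \<Rightarrow> bool" where
  "step_up_procedure m h \<tau> \<longleftrightarrow> threshold_function m \<tau> \<and>
    (\<forall>p \<in> {1..m} \<rightarrow> {0..1}. \<forall>\<alpha>\<in>{0..1}. h p \<alpha> = step_up_rejections m (\<tau> \<alpha>) p)"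

definition union_procedure :: "procedure \<Rightarrow> procedure \<Rightarrow> procedure" where
  "union_procedure h1 h2 = (\<lambda>p \<alpha>. h1 p \<alpha> \<union> h2 p \<alpha>)"

definition threshold_condition :: "nat \<Rightarrow> (real \<Rightarrow> nat \<Rightarrow> real) \<Rightarrow> bool" where
  "threshold_condition m \<tau> \<longleftrightarrow>
    (\<forall>\<alpha>\<in>{0..1}. mono_on {1..m} (\<tau> \<alpha>)) \<and>
    (\<forall>i\<in>{1..m}. continuous_on {0..1} (\<lambda>\<alpha>. \<tau> \<alpha> i) \<and> mono_on {0..1} (\<lambda>\<alpha>. \<tau> \<alpha> i))"

end

theory Submission
  imports Defs
begin

text \<open>An index is rejected exactly when its entry of \<open>p\<close> lies below some order
  statistic that meets its threshold. This criterion is existential in \<open>j\<close>, and being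
  at most \<open>max a b\<close> is a disjunction, so the pointwise maximum of the thresholds
  rejects exactly the union of the two rejection sets (\<open>step_up_rejections_max\<close>). The
  threshold condition survives because monotonicity and continuity both pass to pointwise
  maxima.\<close>

lemma step_up_rejections_iff:
  "i \<in> step_up_rejections m t p \<longleftrightarrow>
    i \<in> {1..m} \<and> (\<exists>j\<in>{1..m}. order_stat m p j \<le> t j \<and> p i \<le> order_stat m p j)"
proof -
  define S where "S = {order_stat m p j | j. j \<in> {1..m} \<and> order_stat m p j \<le> t j}"
  have "finite S"
    unfolding S_def by simp
  then have "(\<exists>s\<in>S. p i \<le> s) \<longleftrightarrow> S \<noteq> {} \<and> p i \<le> Max S"
    \<comment> \<open>\<open>Max_ge_iff\<close> speaks only of nonempty finite sets; for empty
      \<open>S\<close> both sides are false, in line with the convention that the maximum is then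
      minus infinity.\<close>
    by (cases "S = {}") (simp_all add: Max_ge_iff)
  moreover have "i \<in> step_up_rejections m t p \<longleftrightarrow> i \<in> {1..m} \<and> S \<noteq> {} \<and> p i \<le> Max S"
    unfolding step_up_rejections_def S_def[symmetric] Let_def by auto
  moreover have "(\<exists>s\<in>S. p i \<le> s) \<longleftrightarrow>
      (\<exists>j\<in>{1..m}. order_stat m p j \<le> t j \<and> p i \<le> order_stat m p j)"
    unfolding S_def by blast
  ultimately show ?thesis
    by blast
qed

text \<open>The order statistics depend on \<open>p\<close> alone, so both sides range over the same
  witnesses \<open>j\<close>, and the existential quantifier distributes over the
  disjunction.\<close>

lemma step_up_rejections_max:
  "step_up_rejections m (\<lambda>i. max (t i) (t' i)) p =
    step_up_rejections m t p \<union> step_up_rejections m t' p"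
  by (auto simp add: step_up_rejections_iff le_max_iff_disj)

lemma threshold_function_max:
  assumes "threshold_function m \<tau>" and "threshold_function m \<tau>'"
  shows "threshold_function m (\<lambda>\<alpha> i. max (\<tau> \<alpha> i) (\<tau>' \<alpha> i))"
  using assms by (auto simp add: threshold_function_def Pi_iff le_max_iff_disj)

lemma step_up_procedure_union:
  assumes "step_up_procedure m h \<tau>" and "step_up_procedure m h' \<tau>'"
  shows "step_up_procedure m (union_procedure h h') (\<lambda>\<alpha> i. max (\<tau> \<alpha> i) (\<tau>' \<alpha> i))"
  using assms
  by (simp add: step_up_procedure_def union_procedure_def threshold_function_max
      step_up_rejections_max)

text \<open>Stated for general orders because it serves twice: over the indices
  \<open>{1..m}\<close> and over the levels \<open>{0..1}\<close>.\<close>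

lemma mono_on_max:
  fixes f g :: "'a::order \<Rightarrow> 'b::linorder"
  assumes "mono_on A f" and "mono_on A g"
  shows "mono_on A (\<lambda>x. max (f x) (g x))"
  using assms by (intro mono_onI max.mono) (auto dest: mono_onD)

lemma threshold_condition_max:
  assumes "threshold_condition m \<tau>" and "threshold_condition m \<tau>'"
  shows "threshold_condition m (\<lambda>\<alpha> i. max (\<tau> \<alpha> i) (\<tau>' \<alpha> i))"
  using assms by (simp add: threshold_condition_def mono_on_max continuous_on_max)

theorem lemma3:
  fixes m :: nat and h h' :: procedure and \<tau> \<tau>' :: "real \<Rightarrow> nat \<Rightarrow> real"
  assumes "m \<ge> 1"
    and "step_up_procedure m h \<tau>" and "step_up_procedure m h' \<tau>'"
    and "threshold_condition m \<tau>" and "threshold_condition m \<tau>'"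
  shows "step_up_procedure m (union_procedure h h') (\<lambda>\<alpha> i. max (\<tau> \<alpha> i) (\<tau>' \<alpha> i)) \<and>
    threshold_condition m (\<lambda>\<alpha> i. max (\<tau> \<alpha> i) (\<tau>' \<alpha> i))"
  using assms by (simp add: step_up_procedure_union threshold_condition_max)

end
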